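(* Let $p$ be a prime number and $m$ a positive integer. If $A$ is a tile in $\mathbb Z_{p^m}\times\mathbb Z_{p^m}$ with $|A|=p$, then $A$ is spectral in $\mathbb Z_{p^m}\times\mathbb Z_{p^m}$.
   Context: $\mathbb Z_n$ denotes the additive cyclic group of order $n$. A subset $A$ of a finite abelian group $G$ is a tile in $G$ if there is $B\subseteq G$ such that every element of $G$ can be written in exactly one way as $a+b$ with $a\in A$, $b\in B$. For $x=(x_1,x_2)$, $s=(s_1,s_2)$ in $\mathbb Z_n\times\mathbb Z_n$ put $\langle x,s\rangle=x_1s_1+x_2s_2$ (mod $n$). A subset $A\subseteq\mathbb Z_n\times\mathbb Z_n$ is spectral if there is $S\subseteq\mathbb Z_n\times\mathbb Z_n$ such that the family of functions $x\mapsto e^{2\pi i\langle x,s\rangle/n}$ on $A$, indexed by $s\in S$, is an orthogonal basis of $L^2(A)$ with respect to the counting measure on $A$. *)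

theory Defs
  imports
    Complex_Main
    "HOL-Computational_Algebra.Primes"
    "HOL-Library.Function_Algebras"
    "HOL-Algebra.Elementary_Groups"
begin

definition is_tile :: "('a, 'b) monoid_scheme \<Rightarrow> 'a set \<Rightarrow> bool" where
  "is_tile G A \<longleftrightarrow> A \<subseteq> carrier G \<and>
     (\<exists>B \<subseteq> carrier G. \<forall>g \<in> carrier G.
        \<exists>!ab. ab \<in> A \<times> B \<and> g = fst ab \<otimes>\<^bsub>G\<^esub> snd ab)"

text \<open>The elements of \<open>ZZ n\<close> are pairs of residues in \<open>{0..<n}\<close> (for \<open>n > 0\<close>),
  under componentwise addition modulo \<open>n\<close>.\<close>

definition ZZ :: "nat \<Rightarrow> (int \<times> int) monoid" where
  "ZZ n = integer_mod_group n \<times>\<times> integer_mod_group n"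

definition pairing :: "nat \<Rightarrow> int \<times> int \<Rightarrow> int \<times> int \<Rightarrow> int" where
  "pairing n x s = (fst x * fst s + snd x * snd s) mod int n"

definition cscale :: "complex \<Rightarrow> ('a \<Rightarrow> complex) \<Rightarrow> 'a \<Rightarrow> complex" where
  "cscale c f = (\<lambda>x. c * f x)"

interpretation cfun: vector_space "cscale :: complex \<Rightarrow> ('a \<Rightarrow> complex) \<Rightarrow> 'a \<Rightarrow> complex"
  by unfold_locales (auto simp: cscale_def fun_eq_iff algebra_simps)

text \<open>Functions on a finite set \<open>A\<close> are represented by their extension by zero, so that
  they form a subspace of the space of all complex functions. With respect to counting measure
  on a finite set, every such function is square integrable.\<close>

definition L2 :: "'a set \<Rightarrow> ('a \<Rightarrow> complex) set" where
  "L2 A = {f. \<forall>x. x \<notin> A \<longrightarrow> f x = 0}"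

definition L2_inner :: "'a set \<Rightarrow> ('a \<Rightarrow> complex) \<Rightarrow> ('a \<Rightarrow> complex) \<Rightarrow> complex" where
  "L2_inner A f g = (\<Sum>x\<in>A. f x * cnj (g x))"

text \<open>Since a family, rather than a set of functions, is required to be a basis, its members
  must be distinct: hence the injectivity condition.\<close>

definition orthogonal_basis :: "'a set \<Rightarrow> 'i set \<Rightarrow> ('i \<Rightarrow> 'a \<Rightarrow> complex) \<Rightarrow> bool" where
  "orthogonal_basis A S e \<longleftrightarrow>
     pairwise (\<lambda>s t. L2_inner A (e s) (e t) = 0) S \<and>
     inj_on e S \<and> cfun.independent (e ` S) \<and> cfun.span (e ` S) = L2 A"

definition character_on :: "nat \<Rightarrow> (int \<times> int) set \<Rightarrow> int \<times> int \<Rightarrow> int \<times> int \<Rightarrow> complex" where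
  "character_on n A s = (\<lambda>x. if x \<in> A
     then exp (2 * complex_of_real pi * \<i> * of_int (pairing n x s) / of_nat n) else 0)"

definition is_spectral :: "nat \<Rightarrow> (int \<times> int) set \<Rightarrow> bool" where
  "is_spectral n A \<longleftrightarrow> A \<subseteq> carrier (ZZ n) \<and>
     (\<exists>S \<subseteq> carrier (ZZ n). orthogonal_basis A S (character_on n A))"

end

theory Submission
  imports Defs "HOL-Combinatorics.Multiset_Permutations"
begin

text \<open>
  Suppose \<open>A \<oplus> B = G\<close> with \<open>card A = p\<close>. For a prime \<open>q \<noteq> p\<close> and \<open>g \<in> G\<close>, the tuples
  \<open>(a\<^sub>1, \<dots>, a\<^sub>q, b)\<close> with \<open>a\<^sub>1 + \<dots> + a\<^sub>q + b = g\<close> number \<open>p ^ (q - 1)\<close>; permuting the \<open>a\<^sub>i\<close> shows that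
  modulo \<open>q\<close> only the constant tuples count, so \<open>g = q a + b\<close> is solvable. Hence \<open>jA \<oplus> B = G\<close> for
  all \<open>j\<close> coprime to \<open>p\<close> (Tijdeman), which plays the role of Galois conjugation of character sums.
  As \<open>B \<noteq> G\<close>, the character sum of \<open>B\<close> is nonzero at some \<open>s \<noteq> 0\<close>, so that of \<open>jA\<close> vanishes
  at \<open>s\<close>, i.e. that of \<open>A\<close> vanishes at \<open>j s\<close>. Thus \<open>{j s | 0 \<le> j < p}\<close> is a spectrum of \<open>A\<close>.
\<close>

section \<open>Counting lists modulo a prime\<close>

text \<open>Orderings of \<open>M\<close> with a marked occurrence of \<open>x\<close> number
  \<open>count M x\<close> times all orderings, and also \<open>q\<close> times the orderings of
  \<open>M\<close> with one \<open>x\<close> removed. If \<open>q\<close> does not divide the number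
  of orderings, it divides the multiplicity of \<open>x\<close>, so \<open>x\<close> fills all
  \<open>q\<close> places.\<close>

lemma prime_dvd_card_permutations_of_multiset:
  assumes "prime q" "size M = q" "\<And>x. M \<noteq> replicate_mset q x"
  shows "q dvd card (permutations_of_multiset M)"
proof (rule ccontr)
  assume nd: "\<not> q dvd card (permutations_of_multiset M)"
  have "M \<noteq> {#}" using assms(1,2) by auto
  then obtain x where x: "x \<in># M" by blast
  have "q dvd card (permutations_of_multiset M) * count M x"
    using card_permutations_of_multiset_remove_aux[OF x] assms(2) by simp
  then have "q dvd count M x"
    using assms(1) nd by (simp add: prime_dvd_mult_iff)
  then have "q \<le> count M x"
    using x by (simp add: dvd_imp_le)
  then have "replicate_mset q x \<subseteq># M"
    by (simp add: count_le_replicate_mset_subset_eq)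
  then have "replicate_mset q x = M"
    using mset_subset_size[of "replicate_mset q x" M] assms(2) by (auto simp: subset_mset_def)
  with assms(3) show False by blast
qed

text \<open>The rearrangement classes partition \<open>W\<close>, and no class comes from a constant
  multiset, so \<open>q\<close> divides the size of each.\<close>

lemma prime_dvd_card_symmetric_lists:
  assumes "prime q" "finite W"
    and len: "\<And>xs. xs \<in> W \<Longrightarrow> length xs = q"
    and sym: "\<And>xs ys. xs \<in> W \<Longrightarrow> mset ys = mset xs \<Longrightarrow> ys \<in> W"
    and nonconst: "\<And>x. replicate q x \<notin> W"
  shows "q dvd card W"
proof -
  have eq: "W = \<Union> (permutations_of_multiset ` mset ` W)"
    using sym by (auto simp: permutations_of_multiset_def)
  have "q dvd card (permutations_of_multiset (mset xs))" if "xs \<in> W" for xs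
  proof (rule prime_dvd_card_permutations_of_multiset[OF \<open>prime q\<close>])
    show "size (mset xs) = q" using len[OF that] by simp
    show "mset xs \<noteq> replicate_mset q x" for x
      using sym[OF that] nonconst by (metis mset_replicate)
  qed
  moreover have "finite (\<Union> (permutations_of_multiset ` mset ` W))"
    using \<open>finite W\<close> by simp
  ultimately have "q dvd card (\<Union> (permutations_of_multiset ` mset ` W))"
    by (intro dvd_partition) (auto simp: permutations_of_multiset_def)
  then show ?thesis using eq by simp
qed

section \<open>Tilings and their images under power maps\<close>

text \<open>Naming the complement \<open>B\<close> lets it stay fixed while \<open>A\<close> is
  replaced by its powers; the bijection yields both cardinalities and reindexing of sums.\<close>

definition tiling :: "('a, 'b) monoid_scheme \<Rightarrow> 'a set \<Rightarrow> 'a set \<Rightarrow> bool" where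
  "tiling G A B \<longleftrightarrow> A \<subseteq> carrier G \<and> B \<subseteq> carrier G \<and>
     bij_betw (\<lambda>(a, b). a \<otimes>\<^bsub>G\<^esub> b) (A \<times> B) (carrier G)"

lemma (in group) is_tile_imp_tiling:
  assumes "is_tile G A"
  shows "\<exists>B. tiling G A B"
proof -
  have A: "A \<subseteq> carrier G" using assms by (simp add: is_tile_def)
  obtain B where "B \<subseteq> carrier G"
    and uniq: "\<forall>g\<in>carrier G. \<exists>!ab. ab \<in> A \<times> B \<and> g = fst ab \<otimes> snd ab"
    using assms unfolding is_tile_def by (elim conjE exE) (rule that)
  note B = A \<open>B \<subseteq> carrier G\<close> bspec[OF uniq]
  have "inj_on (\<lambda>ab. fst ab \<otimes> snd ab) (A \<times> B)"
  proof (rule inj_onI)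
    fix x y assume xy: "x \<in> A \<times> B" "y \<in> A \<times> B" "fst x \<otimes> snd x = fst y \<otimes> snd y"
    have "fst x \<otimes> snd x \<in> carrier G" using xy(1) B(1,2) by (intro m_closed) auto
    from B(3)[OF this] xy show "x = y"
      by (elim ex1E) metis
  qed
  moreover have "(\<lambda>ab. fst ab \<otimes> snd ab) ` (A \<times> B) = carrier G"
  proof
    show "(\<lambda>ab. fst ab \<otimes> snd ab) ` (A \<times> B) \<subseteq> carrier G" using B(1,2) by (auto intro!: m_closed)
    show "carrier G \<subseteq> (\<lambda>ab. fst ab \<otimes> snd ab) ` (A \<times> B)" using B(3) by blast
  qed
  ultimately show ?thesis
    unfolding tiling_def bij_betw_def case_prod_beta using B(1,2) by blast
qed

lemma (in monoid) foldr_mult_closed: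
  "set xs \<subseteq> carrier G \<Longrightarrow> foldr (\<otimes>) xs \<one> \<in> carrier G"
  by (induction xs) auto

text \<open>Gives the invariance under permutations required by
  \<open>prime_dvd_card_symmetric_lists\<close>. The head of one list is located in the other and
  moved to the front.\<close>

lemma (in comm_monoid) foldr_mult_mset_cong:
  assumes "mset xs = mset ys" "set xs \<subseteq> carrier G"
  shows "foldr (\<otimes>) xs \<one> = foldr (\<otimes>) ys \<one>"
  using assms
proof (induction xs arbitrary: ys)
  case (Cons x xs)
  then have "x \<in> set ys" by (metis list.set_intros(1) mset_eq_setD)
  then obtain us vs where ys: "ys = us @ x # vs" by (auto simp: in_set_conv_decomp)
  have uvs: "mset xs = mset (us @ vs)" using Cons.prems(1) ys by simp
  then have "set (us @ vs) \<subseteq> carrier G"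
    using Cons.prems(2) by (metis mset_eq_setD order_trans set_subset_Cons)
  moreover have "foldr (\<otimes>) (us @ x # vs) \<one> = x \<otimes> foldr (\<otimes>) (us @ vs) \<one>"
    if "set (us @ vs) \<subseteq> carrier G" "x \<in> carrier G" for us
    using that
  proof (induction us)
    case (Cons u us)
    then have "foldr (\<otimes>) (us @ vs) \<one> \<in> carrier G" by (intro foldr_mult_closed) auto
    with Cons show ?case by (simp add: m_lcomm del: foldr_append)
  qed simp
  moreover have "foldr (\<otimes>) xs \<one> = foldr (\<otimes>) (us @ vs) \<one>"
    using Cons.prems by (intro Cons.IH uvs) simp
  ultimately show ?case using Cons.prems(2) ys by simp
qed simp

text \<open>Once the tail of the list is chosen, the tiling determines its head and \<open>b\<close>.\<close>

lemma (in comm_group) card_lists_tiling: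
  assumes T: "tiling G A B" and fin: "finite (carrier G)" and g: "g \<in> carrier G"
  shows "card {xs. length xs = Suc k \<and> set xs \<subseteq> A \<and> (\<exists>b\<in>B. foldr (\<otimes>) xs \<one> \<otimes> b = g)}
    = card A ^ k"
proof -
  have AB: "A \<subseteq> carrier G" "B \<subseteq> carrier G"
    and bij: "bij_betw (\<lambda>(a, b). a \<otimes> b) (A \<times> B) (carrier G)"
    using T by (auto simp: tiling_def)
  have finA: "finite A" using AB fin finite_subset by blast
  let ?W = "{xs. length xs = Suc k \<and> set xs \<subseteq> A \<and> (\<exists>b\<in>B. foldr (\<otimes>) xs \<one> \<otimes> b = g)}"
  let ?L = "{ys. set ys \<subseteq> A \<and> length ys = k}"
  have head: "foldr (\<otimes>) (a # ys) \<one> \<otimes> b = g \<longleftrightarrow> a \<otimes> b = inv (foldr (\<otimes>) ys \<one>) \<otimes> g"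
    if "a \<in> A" "b \<in> B" "ys \<in> ?L" for a b ys
  proof -
    have "a \<in> carrier G" "b \<in> carrier G" and c: "foldr (\<otimes>) ys \<one> \<in> carrier G"
      using that AB by (auto intro!: foldr_mult_closed)
    then have "foldr (\<otimes>) (a # ys) \<one> \<otimes> b = foldr (\<otimes>) ys \<one> \<otimes> (a \<otimes> b)"
      by (simp add: m_ac)
    with g c \<open>a \<in> carrier G\<close> \<open>b \<in> carrier G\<close> show ?thesis
      by (metis inv_solve_left m_closed)
  qed
  have "bij_betw tl ?W ?L"
  proof (rule bij_betwI')
    fix xs xs' assume W: "xs \<in> ?W" "xs' \<in> ?W"
    obtain a ys a' ys' where xs: "xs = a # ys" "xs' = a' # ys'"
      using W by (cases xs; cases xs'; simp)
    obtain b b' where b: "b \<in> B" "b' \<in> B"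
      "foldr (\<otimes>) (a # ys) \<one> \<otimes> b = g" "foldr (\<otimes>) (a' # ys') \<one> \<otimes> b' = g"
      using W unfolding xs by blast
    have L: "a \<in> A" "a' \<in> A" "ys \<in> ?L" "ys' \<in> ?L" using W unfolding xs by auto
    have "a = a'" if "ys = ys'"
    proof -
      have "a \<otimes> b = a' \<otimes> b'"
        using head[OF L(1) b(1) L(3)] head[OF L(2) b(2) L(4)] b(3,4) that by simp
      then show ?thesis
        using inj_onD[OF bij_betw_imp_inj_on[OF bij], of "(a, b)" "(a', b')"] b L by simp
    qed
    then show "tl xs = tl xs' \<longleftrightarrow> xs = xs'" using xs by auto
  next
    fix xs assume "xs \<in> ?W"
    then show "tl xs \<in> ?L" by (cases xs) auto
  next
    fix ys assume ys: "ys \<in> ?L"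
    then have "inv (foldr (\<otimes>) ys \<one>) \<otimes> g \<in> carrier G"
      using AB g foldr_mult_closed[of ys] by auto
    then obtain a b where "a \<in> A" "b \<in> B" "a \<otimes> b = inv (foldr (\<otimes>) ys \<one>) \<otimes> g"
      using bij_betw_imp_surj_on[OF bij] by (force simp: image_iff)
    with ys head[of a b ys] show "\<exists>xs\<in>?W. ys = tl xs"
      by (intro bexI[of _ "a # ys"]) auto
  qed
  then have "card ?W = card ?L" by (rule bij_betw_same_card)
  also have "\<dots> = card A ^ k" using finA by (rule card_lists_length_eq)
  finally show ?thesis .
qed

text \<open>The count modulo \<open>q\<close> gives solvability for every \<open>g\<close>;
  uniqueness then follows because \<open>A \<times> B\<close> and the group have the same finite
  size.\<close>

lemma (in comm_group) tiling_prime_pow: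
  assumes T: "tiling G A B" and fin: "finite (carrier G)"
    and q: "prime q" "\<not> q dvd card A"
  shows "tiling G ((\<lambda>a. a [^] q) ` A) B" "inj_on (\<lambda>a. a [^] q) A"
proof -
  have AB: "A \<subseteq> carrier G" "B \<subseteq> carrier G"
    and bij: "bij_betw (\<lambda>(a, b). a \<otimes> b) (A \<times> B) (carrier G)"
    using T by (auto simp: tiling_def)
  have finA: "finite A" and finB: "finite B" using AB fin finite_subset by blast+
  have foldr_rep: "foldr (\<otimes>) (replicate k a) \<one> = a [^] k" if "a \<in> carrier G" for a k
    using that by (induction k) (simp_all add: m_comm)
  have ex: "\<exists>a\<in>A. \<exists>b\<in>B. a [^] q \<otimes> b = g" if g: "g \<in> carrier G" for g
  proof (rule ccontr)
    assume no: "\<not> (\<exists>a\<in>A. \<exists>b\<in>B. a [^] q \<otimes> b = g)"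
    let ?W = "{xs. length xs = q \<and> set xs \<subseteq> A \<and> (\<exists>b\<in>B. foldr (\<otimes>) xs \<one> \<otimes> b = g)}"
    have "q > 0" using q prime_gt_0_nat by blast
    have "q dvd card ?W"
    proof (rule prime_dvd_card_symmetric_lists[OF \<open>prime q\<close>])
      show "finite ?W"
        using finite_lists_length_eq[OF finA, of q] by (rule rev_finite_subset) auto
      show "length xs = q" if "xs \<in> ?W" for xs using that by simp
      show "ys \<in> ?W" if xs: "xs \<in> ?W" and m: "mset ys = mset xs" for xs ys
      proof -
        have "foldr (\<otimes>) xs \<one> = foldr (\<otimes>) ys \<one>"
          by (rule foldr_mult_mset_cong) (use xs m AB in auto)
        with xs m show ?thesis
          by (auto dest: mset_eq_length mset_eq_setD)
      qed
      show "replicate q x \<notin> ?W" for x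
      proof
        assume "replicate q x \<in> ?W"
        then obtain b where "x \<in> A" "b \<in> B" "foldr (\<otimes>) (replicate q x) \<one> \<otimes> b = g"
          using \<open>q > 0\<close> by (auto simp del: foldr_replicate)
        with no AB foldr_rep[of x q] show False by (metis subsetD)
      qed
    qed
    \<comment> \<open>One of the \<open>q\<close> entries is determined by the others, hence the
      exponent \<open>q - 1\<close>.\<close>
    moreover have "card ?W = card A ^ (q - 1)"
      using card_lists_tiling[OF T fin g, of "q - 1"] \<open>q > 0\<close> by simp
    ultimately have "q dvd card A" using q prime_dvd_power by metis
    with q show False by simp
  qed
  let ?f = "\<lambda>(a, b). a [^] q \<otimes> b"
  have im: "?f ` (A \<times> B) = carrier G"
  proof
    show "?f ` (A \<times> B) \<subseteq> carrier G" using AB by (auto intro!: m_closed nat_pow_closed)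
    show "carrier G \<subseteq> ?f ` (A \<times> B)" using ex by force
  qed
  moreover have "card (carrier G) = card (A \<times> B)"
    using bij_betw_same_card[OF bij] by simp
  ultimately have inj: "inj_on ?f (A \<times> B)"
    using finA finB by (intro eq_card_imp_inj_on) auto
  \<comment> \<open>\<open>b0\<close> witnesses that \<open>B\<close> is nonempty, so that
    injectivity on \<open>A\<close> can be read off from injectivity on the product.\<close>
  have "\<one> \<in> carrier G" by simp
  then obtain b0 where "b0 \<in> B" using ex by blast
  show "inj_on (\<lambda>a. a [^] q) A"
  proof (rule inj_onI)
    fix a a' assume "a \<in> A" "a' \<in> A" "a [^] q = a' [^] q"
    with inj_onD[OF inj, of "(a, b0)" "(a', b0)"] \<open>b0 \<in> B\<close> show "a = a'" by simp
  qed
  \<comment> \<open>\<open>?f\<close> is \<open>?h\<close> followed by multiplication, so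
    injectivity and image pass from \<open>?f\<close> to multiplication on the new product.\<close>
  let ?h = "\<lambda>(a, b). (a [^] q, b)"
  have prod: "(\<lambda>a. a [^] q) ` A \<times> B = ?h ` (A \<times> B)" by force
  have comp: "(\<lambda>(a, b). a \<otimes> b) \<circ> ?h = ?f" by (simp add: fun_eq_iff)
  have "inj_on (\<lambda>(a, b). a \<otimes> b) ((\<lambda>a. a [^] q) ` A \<times> B)"
    unfolding prod using inj by (intro inj_on_imageI) (simp only: comp)
  moreover have "(\<lambda>(a, b). a \<otimes> b) ` ((\<lambda>a. a [^] q) ` A \<times> B) = carrier G"
    unfolding prod image_comp comp by (rule im)
  moreover have "(\<lambda>a. a [^] q) ` A \<subseteq> carrier G"
    using AB(1) by (auto intro: nat_pow_closed)
  ultimately show "tiling G ((\<lambda>a. a [^] q) ` A) B"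
    using AB(2) unfolding tiling_def bij_betw_def by blast
qed

text \<open>Induction over the prime factorization of \<open>j\<close>. Injectivity is carried along
  because it keeps the size of the powered set equal to \<open>card A\<close>, so the next prime
  factor still does not divide it.\<close>

lemma (in comm_group) tiling_pow_coprime:
  assumes "tiling G A B" "finite (carrier G)" "coprime j (card A)" "j \<noteq> 0"
  shows "tiling G ((\<lambda>a. a [^] j) ` A) B \<and> inj_on (\<lambda>a. a [^] j) A"
  using assms(3,4)
proof (induction j rule: prime_divisors_induct)
  case (unit j)
  have "(\<lambda>a. a [^] (1::nat)) ` A = id ` A" "inj_on (\<lambda>a. a [^] (1::nat)) A \<longleftrightarrow> inj_on id A"
    using assms(1) by (intro image_cong inj_on_cong; force simp: tiling_def)+
  with unit assms(1) show ?case by simp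
next
  case (factor q j)
  let ?A = "(\<lambda>a. a [^] j) ` A"
  have A: "A \<subseteq> carrier G" using assms(1) by (simp add: tiling_def)
  have IH: "tiling G ?A B" "inj_on (\<lambda>a. a [^] j) A" using factor by auto
  have "card ?A = card A" using IH(2) by (rule card_image)
  moreover have "coprime q (card A)" using factor.prems by simp
  ultimately have nd: "\<not> q dvd card ?A"
    using factor.hyps by (metis coprime_absorb_left not_prime_unit)
  note * = tiling_prime_pow[OF IH(1) assms(2) factor.hyps nd]
  have "(\<lambda>a. a [^] q) ` ?A = (\<lambda>a. a [^] (q * j)) ` A"
    unfolding image_image using A by (intro image_cong) (auto simp: nat_pow_pow mult.commute)
  moreover have "inj_on (\<lambda>a. a [^] (q * j)) A"
    using comp_inj_on[OF IH(2) *(2)] A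
    by (subst inj_on_cong[where g = "(\<lambda>a. a [^] q) \<circ> (\<lambda>a. a [^] j)"])
      (auto simp: nat_pow_pow mult.commute)
  ultimately show ?case using *(1) by simp
qed simp

section \<open>Pairs of residues, roots of unity and character sums\<close>

lemma comm_group_ZZ: "comm_group (ZZ n)"
proof -
  interpret group "ZZ n" unfolding ZZ_def by (intro DirProd_group) simp_all
  show ?thesis
    by (rule group_comm_groupI) (simp add: ZZ_def mult_DirProd' add.commute)
qed

lemma carrier_ZZ: "n > 0 \<Longrightarrow> carrier (ZZ n) = {0..<int n} \<times> {0..<int n}"
  by (simp add: ZZ_def carrier_integer_mod_group)

lemma mult_ZZ: "x \<otimes>\<^bsub>ZZ n\<^esub> y = ((fst x + fst y) mod int n, (snd x + snd y) mod int n)"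
  by (simp add: ZZ_def mult_DirProd')

lemma pow_ZZ: "x [^]\<^bsub>ZZ n\<^esub> (k::nat) = (int k * fst x mod int n, int k * snd x mod int n)"
proof -
  interpret comm_group "ZZ n" by (rule comm_group_ZZ)
  show ?thesis
  proof (induction k)
    case 0
    show ?case by (simp add: ZZ_def)
  next
    case (Suc k)
    then show ?case by (simp add: mult_ZZ mod_simps algebra_simps)
  qed
qed

text \<open>Exponents are arbitrary integers, so negatives and differences need no reduction;
  \<open>unit_root_mod\<close> returns to residues.\<close>

definition unit_root :: "nat \<Rightarrow> int \<Rightarrow> complex" where
  "unit_root n k = cis (2 * pi * of_int k / of_nat n)"

lemma unit_root_0 [simp]: "unit_root n 0 = 1"
  by (simp add: unit_root_def)

lemma unit_root_add: "unit_root n (j + k) = unit_root n j * unit_root n k"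
  by (simp add: unit_root_def cis_mult add_divide_distrib distrib_left)

lemma cnj_unit_root: "cnj (unit_root n k) = unit_root n (- k)"
  by (simp add: unit_root_def cis_cnj)

lemma unit_root_mult_nat: "unit_root n (int j * k) = unit_root n k ^ j"
  by (simp add: unit_root_def DeMoivre mult_ac)

lemma unit_root_multiple: "n > 0 \<Longrightarrow> unit_root n (int n * k) = 1"
  using cis_multiple_2pi[of "of_int k"] by (simp add: unit_root_def mult.assoc)

lemma unit_root_mod:
  assumes "n > 0"
  shows "unit_root n (k mod int n) = unit_root n k"
proof -
  have "unit_root n k = unit_root n (int n * (k div int n) + k mod int n)" by simp
  also have "\<dots> = unit_root n (k mod int n)"
    using assms by (simp only: unit_root_add unit_root_multiple) simp
  finally show ?thesis by simp
qed

lemma unit_root_eq_1_iff: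
  assumes "n > 0"
  shows "unit_root n k = 1 \<longleftrightarrow> int n dvd k"
proof
  assume "unit_root n k = 1"
  then have "cos (2 * pi * of_int k / of_nat n) = 1"
    by (metis unit_root_def cis.simps(1) one_complex.simps(1))
  then obtain i :: int where "2 * pi * of_int k / of_nat n = of_int i * 2 * pi"
    by (auto simp: cos_one_2pi_int)
  then have "real_of_int k = real_of_int (i * int n)"
    using assms by (simp add: field_simps)
  then have "k = i * int n" by (simp only: of_int_eq_iff)
  then show "int n dvd k" by simp
next
  assume "int n dvd k"
  with assms show "unit_root n k = 1" by (auto simp: unit_root_multiple)
qed

text \<open>A geometric series whose ratio is an \<open>n\<close>-th root of unity, equal to 1
  exactly when \<open>n\<close> divides \<open>t\<close>.\<close>

lemma sum_unit_root:
  assumes "n > 0"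
  shows "(\<Sum>k\<in>{0..<int n}. unit_root n (k * t)) = (if int n dvd t then of_nat n else 0)"
proof -
  let ?z = "unit_root n t"
  have "(\<Sum>k\<in>{0..<int n}. unit_root n (k * t)) = (\<Sum>j<n. ?z ^ j)"
    by (rule sum.reindex_bij_witness[of _ int nat]) (auto simp flip: unit_root_mult_nat)
  also have "\<dots> = (if int n dvd t then of_nat n else 0)"
  proof (cases "int n dvd t")
    case False
    then have "?z \<noteq> 1" using unit_root_eq_1_iff[OF assms] by simp
    moreover have "?z ^ n = 1"
      using unit_root_multiple[OF assms, of t] by (simp add: unit_root_mult_nat)
    ultimately show ?thesis using False by (simp add: geometric_sum)
  qed (use unit_root_eq_1_iff[OF assms, of t] in simp)
  finally show ?thesis .
qed

text \<open>This is \<open>pairing\<close> before reduction modulo \<open>n\<close>, so that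
  bilinearity holds over the integers.\<close>

definition dot :: "int \<times> int \<Rightarrow> int \<times> int \<Rightarrow> int" where
  "dot x s = fst x * fst s + snd x * snd s"

lemma dot_mod:
  "dot (u mod k, v mod k) s mod k = dot (u, v) s mod k"
  "dot s (u mod k, v mod k) mod k = dot s (u, v) mod k"
  unfolding dot_def fst_conv snd_conv by (intro mod_add_cong; simp add: mod_simps)+

lemma sum_unit_root_dot:
  assumes "n > 0"
  shows "(\<Sum>x\<in>carrier (ZZ n). unit_root n (dot x s)) =
    (if int n dvd fst s \<and> int n dvd snd s then of_nat (n ^ 2) else 0)"
proof -
  have "(\<Sum>x\<in>carrier (ZZ n). unit_root n (dot x s)) =
      (\<Sum>k\<in>{0..<int n}. unit_root n (k * fst s)) * (\<Sum>k\<in>{0..<int n}. unit_root n (k * snd s))"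
    unfolding carrier_ZZ[OF assms] sum_product sum.cartesian_product
    by (simp add: dot_def unit_root_add case_prod_beta)
  then show ?thesis
    by (simp add: sum_unit_root[OF assms] power2_eq_square)
qed

text \<open>The Fourier transform of the indicator function of \<open>A\<close>, up to the sign of
  the exponent.\<close>

definition char_sum :: "nat \<Rightarrow> (int \<times> int) set \<Rightarrow> int \<times> int \<Rightarrow> complex" where
  "char_sum n A s = (\<Sum>x\<in>A. unit_root n (dot x s))"

lemma unit_root_dot_mult:
  assumes "n > 0"
  shows "unit_root n (dot (x \<otimes>\<^bsub>ZZ n\<^esub> y) s) = unit_root n (dot x s) * unit_root n (dot y s)"
proof -
  have "dot (x \<otimes>\<^bsub>ZZ n\<^esub> y) s mod int n = (dot x s + dot y s) mod int n"
    unfolding mult_ZZ dot_mod by (simp add: dot_def algebra_simps)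
  then show ?thesis
    by (metis unit_root_mod[OF assms] unit_root_add)
qed

text \<open>Scaling the point and scaling the frequency have the same effect. The first form serves
  dilates of \<open>A\<close>, the second the multiples of \<open>s\<close> in the spectrum.\<close>

lemma unit_root_dot_pow:
  assumes "n > 0"
  shows "unit_root n (dot (x [^]\<^bsub>ZZ n\<^esub> (k::nat)) s) = unit_root n (int k * dot x s)"
    and "unit_root n (dot x (s [^]\<^bsub>ZZ n\<^esub> (k::nat))) = unit_root n (int k * dot x s)"
proof -
  have "dot (x [^]\<^bsub>ZZ n\<^esub> k) s mod int n = int k * dot x s mod int n"
    "dot x (s [^]\<^bsub>ZZ n\<^esub> k) mod int n = int k * dot x s mod int n"
    unfolding pow_ZZ dot_mod by (simp_all add: dot_def algebra_simps)
  then show "unit_root n (dot (x [^]\<^bsub>ZZ n\<^esub> (k::nat)) s) = unit_root n (int k * dot x s)"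
    "unit_root n (dot x (s [^]\<^bsub>ZZ n\<^esub> (k::nat))) = unit_root n (int k * dot x s)"
    by (metis unit_root_mod[OF assms])+
qed

text \<open>The transform turns the convolution of the two indicator functions, constantly 1 for a
  tiling, into a product. At a nonzero frequency one factor must vanish.\<close>

lemma char_sum_tiling:
  assumes "n > 0" "tiling (ZZ n) A B"
  shows "char_sum n A s * char_sum n B s =
    (if int n dvd fst s \<and> int n dvd snd s then of_nat (n ^ 2) else 0)"
proof -
  have bij: "bij_betw (\<lambda>(a, b). a \<otimes>\<^bsub>ZZ n\<^esub> b) (A \<times> B) (carrier (ZZ n))"
    using assms(2) by (simp add: tiling_def)
  have "char_sum n A s * char_sum n B s =
      (\<Sum>z\<in>A \<times> B. unit_root n (dot ((\<lambda>(a, b). a \<otimes>\<^bsub>ZZ n\<^esub> b) z) s))"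
    unfolding char_sum_def sum_product sum.cartesian_product
    by (simp add: unit_root_dot_mult[OF assms(1)] case_prod_beta)
  also have "\<dots> = (\<Sum>x\<in>carrier (ZZ n). unit_root n (dot x s))"
    by (rule sum.reindex_bij_betw[OF bij])
  finally show ?thesis by (simp add: sum_unit_root_dot[OF assms(1)])
qed

text \<open>If the character sum of \<open>B\<close> vanished at every nonzero frequency, Fourier inversion at a
  point of \<open>B\<close> would give \<open>card B = n\<^sup>2\<close>.\<close>

lemma ex_char_sum_nonzero:
  assumes n: "n > 0" and B: "B \<subseteq> carrier (ZZ n)" "B \<noteq> {}" "card B \<noteq> n ^ 2"
  shows "\<exists>s\<in>carrier (ZZ n). s \<noteq> (0, 0) \<and> char_sum n B s \<noteq> 0"
proof (rule ccontr)
  let ?G = "carrier (ZZ n)"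
  assume no: "\<not> ?thesis"
  obtain b0 where b0: "b0 \<in> B" using B by blast
  have G: "?G = {0..<int n} \<times> {0..<int n}" by (rule carrier_ZZ[OF n])
  have finG: "finite ?G" unfolding G by simp
  have finB: "finite B" using B(1) finG finite_subset by blast
  have zero: "(0, 0) \<in> ?G" using n by (simp add: G)
  \<comment> \<open>The inversion sum at \<open>b0\<close> is computed twice. First, by
    \<open>no\<close>, only the zero frequency contributes; afterwards orthogonality of characters
    leaves only \<open>b = b0\<close>.\<close>
  have "(\<Sum>s\<in>?G. char_sum n B s * unit_root n (- dot b0 s)) =
      (\<Sum>s\<in>{(0, 0)}. char_sum n B s * unit_root n (- dot b0 s))"
    using no finG zero by (intro sum.mono_neutral_right) auto
  also have "\<dots> = of_nat (card B)"
    by (simp add: char_sum_def dot_def)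
  finally have 1: "(\<Sum>s\<in>?G. char_sum n B s * unit_root n (- dot b0 s)) = of_nat (card B)" .
  have "(\<Sum>s\<in>?G. char_sum n B s * unit_root n (- dot b0 s)) =
      (\<Sum>s\<in>?G. \<Sum>b\<in>B. unit_root n (dot s (fst b - fst b0, snd b - snd b0)))"
    unfolding char_sum_def sum_distrib_right
    by (simp add: dot_def algebra_simps flip: unit_root_add)
  also have "\<dots> = (\<Sum>b\<in>B. \<Sum>s\<in>?G. unit_root n (dot s (fst b - fst b0, snd b - snd b0)))"
    by (rule sum.swap)
  also have "\<dots> = (\<Sum>b\<in>B. if b = b0 then of_nat (n ^ 2) else 0)"
  proof (rule sum.cong[OF refl])
    fix b assume "b \<in> B"
    with B(1) b0 have rng: "fst b \<in> {0..<int n}" "snd b \<in> {0..<int n}"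
      "fst b0 \<in> {0..<int n}" "snd b0 \<in> {0..<int n}"
      unfolding G by auto
    have eq: "int n dvd x - y \<longleftrightarrow> x = y" if "x \<in> {0..<int n}" "y \<in> {0..<int n}" for x y
      using that by (auto simp flip: mod_eq_dvd_iff)
    show "(\<Sum>s\<in>?G. unit_root n (dot s (fst b - fst b0, snd b - snd b0))) =
        (if b = b0 then of_nat (n ^ 2) else 0)"
      unfolding sum_unit_root_dot[OF n] using rng by (simp add: eq prod_eq_iff)
  qed
  also have "\<dots> = of_nat (n ^ 2)" using finB b0 by simp
  finally have "(of_nat (card B) :: complex) = of_nat (n ^ 2)" using 1 by simp
  with B(3) show False by (simp only: of_nat_eq_iff)
qed

text \<open>All these dilates of \<open>A\<close> share the complement \<open>B\<close>, so one
  nonzero frequency at which the sum of \<open>B\<close> does not vanish serves every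
  \<open>j\<close> at once.\<close>

lemma tiling_character_zero:
  assumes n: "n > 0" and T: "tiling (ZZ n) A B" and "card A \<noteq> 1"
  obtains s where "s \<in> carrier (ZZ n)"
    "\<And>j. coprime j (card A) \<Longrightarrow> j \<noteq> 0 \<Longrightarrow> (\<Sum>a\<in>A. unit_root n (int j * dot a s)) = 0"
proof -
  interpret comm_group "ZZ n" by (rule comm_group_ZZ)
  have G: "carrier (ZZ n) = {0..<int n} \<times> {0..<int n}" by (rule carrier_ZZ[OF n])
  have finG: "finite (carrier (ZZ n))" unfolding G by simp
  have AB: "A \<subseteq> carrier (ZZ n)" "B \<subseteq> carrier (ZZ n)"
    and bij: "bij_betw (\<lambda>(a, b). a \<otimes>\<^bsub>ZZ n\<^esub> b) (A \<times> B) (carrier (ZZ n))"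
    using T by (auto simp: tiling_def)
  have card: "card A * card B = n ^ 2"
    using bij_betw_same_card[OF bij] by (simp add: G card_cartesian_product power2_eq_square)
  have "B \<noteq> {}" using card n by auto
  \<comment> \<open>The sizes multiply to \<open>n ^ 2\<close>, so \<open>card A \<noteq> 1\<close>
    makes \<open>B\<close> a proper subset.\<close>
  moreover have "card B \<noteq> n ^ 2" using card n \<open>card A \<noteq> 1\<close> by auto
  ultimately obtain s where s: "s \<in> carrier (ZZ n)" "s \<noteq> (0, 0)" "char_sum n B s \<noteq> 0"
    using ex_char_sum_nonzero[OF n AB(2)] by blast
  have ndvd: "\<not> (int n dvd fst s \<and> int n dvd snd s)"
    using s(1,2) by (auto simp: G prod_eq_iff dest: zdvd_imp_le)
  have "(\<Sum>a\<in>A. unit_root n (int j * dot a s)) = 0" if "coprime j (card A)" "j \<noteq> 0" for j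
  proof -
    let ?A = "(\<lambda>a. a [^]\<^bsub>ZZ n\<^esub> j) ` A"
    have T': "tiling (ZZ n) ?A B" and inj: "inj_on (\<lambda>a. a [^]\<^bsub>ZZ n\<^esub> j) A"
      using tiling_pow_coprime[OF T finG that] by auto
    have "char_sum n ?A s = 0"
      using char_sum_tiling[OF n T', of s] ndvd s(3) by auto
    then show ?thesis
      unfolding char_sum_def sum.reindex[OF inj] by (simp add: unit_root_dot_pow[OF n])
  qed
  with s(1) that show thesis by blast
qed

section \<open>Orthogonal bases of functions on a finite set\<close>

lemma L2_inner_commute: "L2_inner A f g = cnj (L2_inner A g f)"
  by (simp add: L2_inner_def mult.commute)

lemma subspace_L2: "cfun.subspace (L2 A)"
  by (simp add: cfun.subspace_def L2_def cscale_def zero_fun_def plus_fun_def)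

lemma subspace_L2_inner_zero: "cfun.subspace {f. L2_inner A f g = 0}"
  by (simp add: cfun.subspace_def L2_inner_def cscale_def zero_fun_def plus_fun_def
      distrib_right sum.distrib mult.assoc flip: sum_distrib_left)

text \<open>A member in the span of the others would be orthogonal to itself.\<close>

lemma orthogonal_imp_independent:
  assumes "pairwise (\<lambda>f g. L2_inner A f g = 0) P" "\<And>f. f \<in> P \<Longrightarrow> L2_inner A f f \<noteq> 0"
  shows "cfun.independent P"
  unfolding cfun.dependent_def
proof
  assume "\<exists>f\<in>P. f \<in> cfun.span (P - {f})"
  then obtain f where f: "f \<in> P" "f \<in> cfun.span (P - {f})" by blast
  have "cfun.span (P - {f}) \<subseteq> {g. L2_inner A g f = 0}"
    using assms(1) f(1) by (intro cfun.span_minimal subspace_L2_inner_zero) (auto simp: pairwise_def)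
  with f assms(2) show False by auto
qed

text \<open>Bounds the dimension of \<open>L2 A\<close> by \<open>card A\<close>.\<close>

lemma L2_subset_span_delta:
  assumes "finite A"
  shows "L2 A \<subseteq> cfun.span ((\<lambda>a x. if x = a then 1 else 0) ` A)"
proof
  fix f assume f: "f \<in> L2 A"
  let ?D = "(\<lambda>a x. if x = a then 1 else 0) ` A"
  have "(\<lambda>x. if x \<in> T then f x else 0) \<in> cfun.span ?D" if "finite T" "T \<subseteq> A" for T
    using that
  proof (induction T)
    case empty
    then show ?case using cfun.span_zero[of ?D] by (simp add: zero_fun_def)
  next
    case (insert t T)
    have "(\<lambda>x. if x \<in> insert t T then f x else 0) =
        cscale (f t) (\<lambda>x. if x = t then 1 else 0) + (\<lambda>x. if x \<in> T then f x else 0)"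
      using insert.hyps by (auto simp: fun_eq_iff cscale_def)
    also have "\<dots> \<in> cfun.span ?D"
    proof (rule cfun.span_add)
      show "cscale (f t) (\<lambda>x. if x = t then 1 else 0) \<in> cfun.span ?D"
        using insert.prems by (intro cfun.span_scale cfun.span_base) auto
      show "(\<lambda>x. if x \<in> T then f x else 0) \<in> cfun.span ?D"
        using insert.prems by (intro insert.IH) auto
    qed
    finally show ?case .
  qed
  from this[OF assms order_refl] have "(\<lambda>x. if x \<in> A then f x else 0) \<in> cfun.span ?D" .
  moreover have "(\<lambda>x. if x \<in> A then f x else 0) = f"
    using f by (auto simp: L2_def fun_eq_iff)
  ultimately show "f \<in> cfun.span ?D" by (simp only:)
qed

text \<open>Spanning comes from a dimension count: \<open>card A\<close> nonzero orthogonal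
  functions are independent, and one more independent function in \<open>L2 A\<close> would exceed
  the bound.\<close>

lemma orthogonal_basisI:
  assumes "finite A" "card S = card A" "finite S"
    and orth: "pairwise (\<lambda>s t. L2_inner A (e s) (e t) = 0) S"
    and nz: "\<And>s. s \<in> S \<Longrightarrow> L2_inner A (e s) (e s) \<noteq> 0"
    and L2: "\<And>s. s \<in> S \<Longrightarrow> e s \<in> L2 A"
  shows "orthogonal_basis A S e"
proof -
  \<comment> \<open>If \<open>e s = e t\<close> with \<open>s \<noteq> t\<close>, then
    \<open>e s\<close> would be orthogonal to itself.\<close>
  have inj: "inj_on e S"
    using orth nz by (metis (mono_tags, lifting) inj_onI pairwiseD)
  have indep: "cfun.independent (e ` S)"
    using orth nz by (intro orthogonal_imp_independent[of A]) (auto simp: pairwise_def)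
  have "f \<in> cfun.span (e ` S)" if f: "f \<in> L2 A" for f
  proof (rule ccontr)
    assume nf: "f \<notin> cfun.span (e ` S)"
    then have "f \<notin> e ` S" using cfun.span_base by blast
    then have "card (insert f (e ` S)) = Suc (card A)"
      using inj assms(2,3) by (simp add: card_image)
    moreover have "cfun.independent (insert f (e ` S))"
      using nf indep by (rule cfun.independent_insertI)
    moreover let ?D = "(\<lambda>a x. if x = a then 1 else 0 :: complex) ` A"
    have "insert f (e ` S) \<subseteq> cfun.span ?D"
      using L2_subset_span_delta[OF \<open>finite A\<close>] f L2 by auto
    ultimately have "Suc (card A) \<le> card ?D"
      using cfun.independent_span_bound[of ?D "insert f (e ` S)"] \<open>finite A\<close> by simp
    with card_image_le[OF \<open>finite A\<close>, of "\<lambda>a x. if x = a then 1 else 0 :: complex"] show False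
      by simp
  qed
  moreover have "cfun.span (e ` S) \<subseteq> L2 A"
    using L2 by (intro cfun.span_minimal subspace_L2) auto
  ultimately show ?thesis
    using orth inj indep unfolding orthogonal_basis_def by blast
qed

section \<open>The spectrum of a tile of prime size\<close>

lemma character_on_unit_root:
  assumes "n > 0" "x \<in> A"
  shows "character_on n A s x = unit_root n (dot x s)"
proof -
  have "character_on n A s x = unit_root n (dot x s mod int n)"
    using assms(2) by (simp add: character_on_def pairing_def dot_def unit_root_def cis_conv_exp
        mult_ac)
  then show ?thesis by (simp add: unit_root_mod[OF assms(1)])
qed

theorem lemma11:
  fixes p m :: nat and A :: "(int \<times> int) set"
  assumes "prime p" and "m > 0"
    and "is_tile (ZZ (p ^ m)) A" and "card A = p"
  shows "is_spectral (p ^ m) A"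
proof -
  define n where "n = p ^ m"
  have n: "n > 0" using \<open>prime p\<close> by (simp add: n_def prime_gt_0_nat)
  interpret comm_group "ZZ n" by (rule comm_group_ZZ)
  have "is_tile (ZZ n) A" using assms(3) by (simp only: n_def)
  from is_tile_imp_tiling[OF this] obtain B where T: "tiling (ZZ n) A B" ..
  have finA: "finite A" using assms(1,4) by (metis card.infinite not_prime_0)
  have "card A \<noteq> 1" using assms(1,4) by (metis not_prime_1)
  then obtain s where s: "s \<in> carrier (ZZ n)"
    and zero: "\<And>j. coprime j (card A) \<Longrightarrow> j \<noteq> 0 \<Longrightarrow> (\<Sum>a\<in>A. unit_root n (int j * dot a s)) = 0"
    by (rule tiling_character_zero[OF n T]) (rule that)
  let ?e = "\<lambda>j::nat. character_on n A (s [^]\<^bsub>ZZ n\<^esub> j)"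
  \<comment> \<open>The inner product depends only on the difference of the multiples of
    \<open>s\<close>.\<close>
  have inner: "L2_inner A (?e i) (?e j) = (\<Sum>a\<in>A. unit_root n ((int i - int j) * dot a s))" for i j
    unfolding L2_inner_def
    by (intro sum.cong refl)
      (simp add: character_on_unit_root[OF n] unit_root_dot_pow[OF n] cnj_unit_root left_diff_distrib
        flip: unit_root_add)
  \<comment> \<open>Since \<open>0 < i - j < p\<close>, the difference is coprime to
    \<open>p = card A\<close>. The order \<open>j < i\<close> keeps the natural subtraction
    exact.\<close>
  have less: "L2_inner A (?e i) (?e j) = 0" if "j < i" "i < p" for i j
  proof -
    have "\<not> p dvd i - j" using that by (auto dest!: dvd_imp_le)
    then have "coprime (i - j) (card A)"
      using assms(1,4) by (simp add: prime_imp_coprime coprime_commute)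
    then have "(\<Sum>a\<in>A. unit_root n (int (i - j) * dot a s)) = 0"
      using that by (intro zero) auto
    then show ?thesis using that by (simp add: inner of_nat_diff)
  qed
  have orth: "L2_inner A (?e i) (?e j) = 0" if "i \<noteq> j" "i < p" "j < p" for i j
    using that less[of i j] less[of j i] L2_inner_commute[of A "?e i" "?e j"]
    by (cases i j rule: linorder_cases) auto
  \<comment> \<open>On the diagonal every term is 1, so the sum is \<open>p\<close>.\<close>
  have nz: "L2_inner A (?e i) (?e i) \<noteq> 0" for i
    using assms(1,4) by (auto simp: inner)
  define S where "S = (\<lambda>j::nat. s [^]\<^bsub>ZZ n\<^esub> j) ` {..<p}"
  \<comment> \<open>Coinciding multiples of \<open>s\<close> would have inner product both zero and
    nonzero. Hence there are \<open>p\<close> distinct frequencies, as many as a basis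
    needs.\<close>
  have "inj_on (\<lambda>j::nat. s [^]\<^bsub>ZZ n\<^esub> j) {..<p}"
  proof (rule inj_onI)
    fix i j :: nat
    assume "i \<in> {..<p}" "j \<in> {..<p}" "s [^]\<^bsub>ZZ n\<^esub> i = s [^]\<^bsub>ZZ n\<^esub> j"
    with orth[of i j] nz[of i] show "i = j" by auto
  qed
  then have "card S = card A" using assms(4) by (simp add: S_def card_image)
  moreover have "pairwise (\<lambda>s t. L2_inner A (character_on n A s) (character_on n A t) = 0) S"
    unfolding pairwise_def S_def by (auto intro!: orth)
  ultimately have "orthogonal_basis A S (character_on n A)"
  proof (intro orthogonal_basisI[OF finA])
    show "finite S" by (simp add: S_def)
    show "L2_inner A (character_on n A t) (character_on n A t) \<noteq> 0" if "t \<in> S" for t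
      using that nz by (auto simp: S_def)
    show "character_on n A t \<in> L2 A" for t by (simp add: L2_def character_on_def)
  qed
  moreover have "S \<subseteq> carrier (ZZ n)" using s by (auto simp: S_def)
  moreover have "A \<subseteq> carrier (ZZ n)" using T by (simp add: tiling_def)
  ultimately show ?thesis unfolding is_spectral_def n_def by blast
qed

end
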